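(* Let $m\ge 1$ independent events be given, event $\ell$ having outcomes $\{1,\dots,n_\ell\}$, probabilities $p_{\ell i}>0$ with $\sum_{i} p_{\ell i}=1$, and prices $\pi_{\ell i}>0$, and let $U$ be an admissible utility. Fix a support family $A=(A_1,\dots,A_m)$ with $A_\ell\subseteq\{1,\dots,n_\ell\}$, and let $(c,g)$ be optimal for the problem of maximizing $\Phi$ restricted to feasible portfolios supported on $A$. Assume $c>0$. Then for every event $\ell$, $$\frac{\lambda}{K_\ell^{(U)}}=\frac{1-P_{\ell,A}}{1-Q_{\ell,A}},$$ where $\lambda$ is the multiplier of the budget constraint, $K_\ell^{(U)}:=\mathbb{E}_{-\ell}\bigl[U'(R_\ell(X_{-\ell}))\bigr]$, $P_{\ell,A}:=\sum_{i\in A_\ell}p_{\ell i}$ and $Q_{\ell,A}:=\sum_{i\in A_\ell}\pi_{\ell i}$.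
   Context: An admissible utility is a function $U:(0,\infty)\to\mathbb{R}$ that is $C^1$, satisfies $U'(w)>0$ for all $w>0$, and is strictly concave. The random product-state is $X=(X_1,\dots,X_m)$ with $X_1,\dots,X_m$ independent and $\mathbb{P}(X_\ell=i)=p_{\ell i}$. A feasible portfolio is a pair $(c,g)$ with $c\ge 0$, $g_{\ell i}\ge 0$ for all $\ell,i$, satisfying the budget constraint $c+\sum_{\ell=1}^m\sum_{i=1}^{n_\ell}\pi_{\ell i}g_{\ell i}=1$ and such that the terminal wealth $W(x):=c+\sum_{\ell=1}^m g_{\ell,x_\ell}$ is strictly positive for every product-state $x$. The objective is $\Phi(c,g):=\mathbb{E}[U(W(X))]$. A portfolio $(c,g)$ is supported on $A$ if, for every $\ell$, $g_{\ell i}>0$ for all $i\in A_\ell$ and $g_{\ell i}=0$ for all $i\notin A_\ell$. For fixed $\ell$, $X_{-\ell}:=(X_r)_{r\ne\ell}$, $\mathbb{E}_{-\ell}$ is expectation over $X_{-\ell}$, and $R_\ell(X_{-\ell}):=c+\sum_{r\neq\ell}g_{r,X_r}$. The multiplier $\lambda>0$ is the number satisfying the first-order conditions $\lambda=\mathbb{E}[U'(W(X))]$ and $p_{\ell i}\,\mathbb{E}_{-\ell}[U'(g_{\ell i}+R_\ell(X_{-\ell}))]=\lambda\pi_{\ell i}$ for every $\ell$ and every $i\in A_\ell$; it exists at the restricted optimum $(c,g)$ with $c>0$.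
   Formalization: The quotient identity is stated for events whose A_ℓ is not the full outcome set (there Q<1 is proved too); if A_ℓ is the full set then P=Q=1 and the quotient is 0/0, so for every event the identity is given as (λ/K)(1−Q)=1−P. *)

theory Defs
  imports "HOL-Probability.Probability"
begin

definition strictly_concave_on :: "real set \<Rightarrow> (real \<Rightarrow> real) \<Rightarrow> bool" where
  "strictly_concave_on S f \<longleftrightarrow> convex S \<and>
     (\<forall>x\<in>S. \<forall>y\<in>S. \<forall>t. x \<noteq> y \<and> 0 < t \<and> t < 1 \<longrightarrow>
        (1 - t) * f x + t * f y < f ((1 - t) * x + t * y))"

(* Values of U outside (0,\<infinity>) are irrelevant everywhere below. *)
definition admissible_utility :: "(real \<Rightarrow> real) \<Rightarrow> bool" where
  "admissible_utility U \<longleftrightarrow>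
     U C1_differentiable_on {0<..} \<and> (\<forall>w>0. deriv U w > 0) \<and> strictly_concave_on {0<..} U"

(* Events are l = 1..m; event l has outcomes 1..n l.  Functions such as
   p, \<pi> and g are only ever read at such pairs (l, i). *)
definition product_states :: "nat \<Rightarrow> (nat \<Rightarrow> nat) \<Rightarrow> (nat \<Rightarrow> nat) set" where
  "product_states m n = (\<Pi>\<^sub>E l\<in>{1..m}. {1..n l})"

definition wealth :: "nat \<Rightarrow> real \<Rightarrow> (nat \<Rightarrow> nat \<Rightarrow> real) \<Rightarrow> (nat \<Rightarrow> nat) \<Rightarrow> real" where
  "wealth m c g x = c + (\<Sum>l=1..m. g l (x l))"

(* The wealth contributed by cash and all events other than l; it does not depend on x l. *)
definition rest_wealth ::
    "nat \<Rightarrow> nat \<Rightarrow> real \<Rightarrow> (nat \<Rightarrow> nat \<Rightarrow> real) \<Rightarrow> (nat \<Rightarrow> nat) \<Rightarrow> real" where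
  "rest_wealth m l c g x = c + (\<Sum>r\<in>{1..m} - {l}. g r (x r))"

definition feasible ::
    "nat \<Rightarrow> (nat \<Rightarrow> nat) \<Rightarrow> (nat \<Rightarrow> nat \<Rightarrow> real) \<Rightarrow> real \<Rightarrow> (nat \<Rightarrow> nat \<Rightarrow> real) \<Rightarrow> bool" where
  "feasible m n \<pi> c g \<longleftrightarrow>
     c \<ge> 0 \<and> (\<forall>l\<in>{1..m}. \<forall>i\<in>{1..n l}. g l i \<ge> 0) \<and>
     c + (\<Sum>l=1..m. \<Sum>i=1..n l. \<pi> l i * g l i) = 1 \<and>
     (\<forall>x\<in>product_states m n. wealth m c g x > 0)"

definition supported_on ::
    "nat \<Rightarrow> (nat \<Rightarrow> nat) \<Rightarrow> (nat \<Rightarrow> nat set) \<Rightarrow> (nat \<Rightarrow> nat \<Rightarrow> real) \<Rightarrow> bool" where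
  "supported_on m n A g \<longleftrightarrow>
     (\<forall>l\<in>{1..m}. (\<forall>i\<in>A l. g l i > 0) \<and> (\<forall>i\<in>{1..n l} - A l. g l i = 0))"

(* X l is the random outcome of event l, on an underlying probability space M. *)
definition random_product_state ::
    "nat \<Rightarrow> (nat \<Rightarrow> nat) \<Rightarrow> (nat \<Rightarrow> nat \<Rightarrow> real) \<Rightarrow> 'w measure \<Rightarrow> (nat \<Rightarrow> 'w \<Rightarrow> nat) \<Rightarrow> bool" where
  "random_product_state m n p M X \<longleftrightarrow>
     prob_space M \<and>
     prob_space.indep_vars M (\<lambda>l. count_space {1..n l}) X {1..m} \<and>
     (\<forall>l\<in>{1..m}. \<forall>i\<in>{1..n l}. measure M {\<omega>\<in>space M. X l \<omega> = i} = p l i)"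

definition expected_utility ::
    "'w measure \<Rightarrow> (nat \<Rightarrow> 'w \<Rightarrow> nat) \<Rightarrow> nat \<Rightarrow> (real \<Rightarrow> real) \<Rightarrow> real \<Rightarrow> (nat \<Rightarrow> nat \<Rightarrow> real) \<Rightarrow> real"
  where
  "expected_utility M X m U c g = (\<integral>\<omega>. U (wealth m c g (\<lambda>l. X l \<omega>)) \<partial>M)"

definition restricted_optimum ::
    "'w measure \<Rightarrow> (nat \<Rightarrow> 'w \<Rightarrow> nat) \<Rightarrow> nat \<Rightarrow> (nat \<Rightarrow> nat) \<Rightarrow> (nat \<Rightarrow> nat \<Rightarrow> real) \<Rightarrow>
     (real \<Rightarrow> real) \<Rightarrow> (nat \<Rightarrow> nat set) \<Rightarrow> real \<Rightarrow> (nat \<Rightarrow> nat \<Rightarrow> real) \<Rightarrow> bool" where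
  "restricted_optimum M X m n \<pi> U A c g \<longleftrightarrow>
     feasible m n \<pi> c g \<and> supported_on m n A g \<and>
     (\<forall>c' g'. feasible m n \<pi> c' g' \<and> supported_on m n A g' \<longrightarrow>
        expected_utility M X m U c' g' \<le> expected_utility M X m U c g)"

(* Expectations over the outcomes of the events other than l are taken on M: the
   integrands involve X only through rest_wealth. *)
definition budget_multiplier ::
    "'w measure \<Rightarrow> (nat \<Rightarrow> 'w \<Rightarrow> nat) \<Rightarrow> nat \<Rightarrow> (nat \<Rightarrow> nat \<Rightarrow> real) \<Rightarrow> (nat \<Rightarrow> nat \<Rightarrow> real) \<Rightarrow>
     (real \<Rightarrow> real) \<Rightarrow> (nat \<Rightarrow> nat set) \<Rightarrow> real \<Rightarrow> (nat \<Rightarrow> nat \<Rightarrow> real) \<Rightarrow> real \<Rightarrow> bool" where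
  "budget_multiplier M X m p \<pi> U A c g lam \<longleftrightarrow>
     lam > 0 \<and>
     lam = (\<integral>\<omega>. deriv U (wealth m c g (\<lambda>l. X l \<omega>)) \<partial>M) \<and>
     (\<forall>l\<in>{1..m}. \<forall>i\<in>A l.
        p l i * (\<integral>\<omega>. deriv U (g l i + rest_wealth m l c g (\<lambda>r. X r \<omega>)) \<partial>M) = lam * \<pi> l i)"

definition K_factor ::
    "'w measure \<Rightarrow> (nat \<Rightarrow> 'w \<Rightarrow> nat) \<Rightarrow> nat \<Rightarrow> (real \<Rightarrow> real) \<Rightarrow> real \<Rightarrow> (nat \<Rightarrow> nat \<Rightarrow> real) \<Rightarrow>
     nat \<Rightarrow> real" where
  "K_factor M X m U c g l = (\<integral>\<omega>. deriv U (rest_wealth m l c g (\<lambda>r. X r \<omega>)) \<partial>M)"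

end

theory Submission
  imports Defs
begin

text \<open>Moving a small amount of cash into a supported bet \<open>(l, i)\<close>, or out of it, keeps the
  portfolio feasible and supported on \<open>A\<close>, so optimality makes the directional derivative vanish:
  the expectation of \<open>U'(W) (1[X l = i] - \<pi> l i)\<close> is zero.  By independence this is the
  first-order condition with multiplier \<open>\<lambda> = E U'(W)\<close>.  Splitting \<open>E U'(W)\<close> according to the value
  of \<open>X l\<close>, an outcome \<open>i\<close> in \<open>A l\<close> contributes \<open>\<lambda> \<pi> l i\<close> and any other contributes \<open>p l i K\<close>,
  since no wealth is staked on it.  Hence \<open>\<lambda> = \<lambda> Q + (1 - P) K\<close>.\<close>

section \<open>Finitely valued random variables and independence\<close>

text \<open>\<open>Y\<close> splits the space into finitely many measurable level sets, so
  \<open>F (Y \<omega>)\<close> is a finite combination of their indicators, for an arbitrary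
  \<open>F\<close>.\<close>

lemma (in prob_space) expectation_finite_range:
  fixes F :: "'b \<Rightarrow> real"
  assumes Y: "Y \<in> measurable M (count_space S)" and S: "finite S"
  shows "integrable M (\<lambda>\<omega>. F (Y \<omega>))"
    and "expectation (\<lambda>\<omega>. F (Y \<omega>)) = (\<Sum>x\<in>S. prob {\<omega> \<in> space M. Y \<omega> = x} * F x)"
proof -
  have meas: "{\<omega> \<in> space M. Y \<omega> = x} \<in> sets M" if "x \<in> S" for x
  proof -
    have "Y -` {x} \<inter> space M \<in> sets M"
      using measurable_sets[OF Y, of "{x}"] that by simp
    also have "Y -` {x} \<inter> space M = {\<omega> \<in> space M. Y \<omega> = x}" by auto
    finally show ?thesis .
  qed
  have eq: "F (Y \<omega>) = (\<Sum>x\<in>S. indicator {\<omega> \<in> space M. Y \<omega> = x} \<omega> * F x)" if "\<omega> \<in> space M" for \<omega>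
  proof -
    have "Y \<omega> \<in> S" using measurable_space[OF Y that] by simp
    have "(\<Sum>x\<in>S. indicator {\<omega> \<in> space M. Y \<omega> = x} \<omega> * F x) = (\<Sum>x\<in>S. if x = Y \<omega> then F x else 0)"
      using that by (intro sum.cong) (auto simp: indicator_def)
    then show ?thesis using \<open>Y \<omega> \<in> S\<close> S by simp
  qed
  have int: "integrable M (\<lambda>\<omega>. indicator {\<omega> \<in> space M. Y \<omega> = x} \<omega> * F x)" if "x \<in> S" for x
    using meas[OF that] by (intro integrable_mult_left integrable_real_indicator)
      (auto simp: emeasure_eq_measure)
  show "integrable M (\<lambda>\<omega>. F (Y \<omega>))"
    using int by (subst Bochner_Integration.integrable_cong[OF refl eq]) auto
  have "expectation (\<lambda>\<omega>. F (Y \<omega>)) =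
      expectation (\<lambda>\<omega>. \<Sum>x\<in>S. indicator {\<omega> \<in> space M. Y \<omega> = x} \<omega> * F x)"
    by (rule Bochner_Integration.integral_cong[OF refl eq])
  also have "\<dots> = (\<Sum>x\<in>S. expectation (\<lambda>\<omega>. indicator {\<omega> \<in> space M. Y \<omega> = x} \<omega> * F x))"
    by (rule Bochner_Integration.integral_sum[OF int])
  also have "\<dots> = (\<Sum>x\<in>S. prob {\<omega> \<in> space M. Y \<omega> = x} * F x)"
    using meas by (intro sum.cong) (auto simp: Int_absorb2)
  finally show "expectation (\<lambda>\<omega>. F (Y \<omega>)) = (\<Sum>x\<in>S. prob {\<omega> \<in> space M. Y \<omega> = x} * F x)" .
qed

text \<open>The two factors are functions of the disjoint blocks \<open>{l}\<close> and
  \<open>I - {l}\<close> of an independent family, hence independent, and the expectation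
  factorises.\<close>

lemma (in prob_space) expectation_of_bool_mult_indep:
  fixes h :: "('i \<Rightarrow> 'b) \<Rightarrow> real"
  assumes ind: "indep_vars (\<lambda>l. count_space (N l)) X I" and I: "finite I" "l \<in> I"
    and N: "\<And>l. finite (N l)"
  shows "expectation (\<lambda>\<omega>. of_bool (X l \<omega> = i) * h (\<lambda>r\<in>I - {l}. X r \<omega>)) =
    prob {\<omega> \<in> space M. X l \<omega> = i} * expectation (\<lambda>\<omega>. h (\<lambda>r\<in>I - {l}. X r \<omega>))"
proof -
  \<comment> \<open>A finite product of finite discrete spaces is again discrete, which makes every
    \<open>h\<close> measurable.\<close>
  have PiM: "PiM J (\<lambda>l. count_space (N l)) = count_space (PiE J N)" if "J \<subseteq> I" for J
    using that I N by (intro count_space_PiM_finite countable_finite) (auto intro: finite_subset)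
  have fin: "finite (PiE J N)" if "J \<subseteq> I" for J
    using that I N by (intro finite_PiE) (auto intro: finite_subset)
  have rv: "X r \<in> measurable M (count_space (N r))" if "r \<in> I" for r
    using ind that by (simp add: indep_vars_def2)
  have Xl: "expectation (\<lambda>\<omega>. of_bool (X l \<omega> = i)) = prob {\<omega> \<in> space M. X l \<omega> = i}"
  proof -
    have "expectation (\<lambda>\<omega>. of_bool (X l \<omega> = i)) =
        expectation (indicator {\<omega> \<in> space M. X l \<omega> = i} :: _ \<Rightarrow> real)"
      by (intro Bochner_Integration.integral_cong) (auto simp: indicator_def)
    then show ?thesis by (simp add: Int_absorb2)
  qed
  define Y where "Y J \<omega> = (\<lambda>r\<in>J. X r \<omega>)" for J \<omega>
  have Y: "Y J \<in> measurable M (count_space (PiE J N))" if "J \<subseteq> I" for J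
    unfolding Y_def PiM[OF that, symmetric] using that rv by (intro measurable_restrict) auto
  have "indep_var (count_space (PiE {l} N)) (Y {l}) (count_space (PiE (I - {l}) N)) (Y (I - {l}))"
    using indep_var_restrict[OF ind, of "{l}" "I - {l}"] I PiM unfolding Y_def by auto
  then have ind': "indep_var borel ((\<lambda>x. of_bool (x l = i) :: real) \<circ> Y {l}) borel (h \<circ> Y (I - {l}))"
    by (rule indep_var_compose) auto
  have int: "integrable M (f \<circ> Y J)" if "J \<subseteq> I" for J and f :: "_ \<Rightarrow> real"
    unfolding o_def using expectation_finite_range(1)[OF Y[OF that] fin[OF that]] .
  have "expectation (\<lambda>\<omega>. ((\<lambda>x. of_bool (x l = i) :: real) \<circ> Y {l}) \<omega> * (h \<circ> Y (I - {l})) \<omega>) =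
      expectation ((\<lambda>x. of_bool (x l = i)) \<circ> Y {l}) * expectation (h \<circ> Y (I - {l}))"
    using I by (intro indep_var_lebesgue_integral[OF ind' int int]) auto
  then show ?thesis
    by (simp add: Y_def o_def Xl)
qed

section \<open>Expectations over the random product-state\<close>

text \<open>The joint outcome is restricted to \<open>{1..m}\<close> because the elements of
  \<open>product_states\<close> are extensional.\<close>

lemma random_product_state_measurable:
  assumes "random_product_state m n p M X"
  shows "(\<lambda>\<omega>. \<lambda>l\<in>{1..m}. X l \<omega>) \<in> measurable M (count_space (product_states m n))"
proof -
  interpret prob_space M using assms by (simp add: random_product_state_def)
  have "X l \<in> measurable M (count_space {1..n l})" if "l \<in> {1..m}" for l
    using assms that by (auto simp: random_product_state_def indep_vars_def2)
  then have "(\<lambda>\<omega>. \<lambda>l\<in>{1..m}. X l \<omega>) \<in> measurable M (PiM {1..m} (\<lambda>l. count_space {1..n l}))"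
    by (intro measurable_restrict) auto
  also have "PiM {1..m} (\<lambda>l. count_space {1..n l}) = count_space (product_states m n)"
    unfolding product_states_def by (intro count_space_PiM_finite) auto
  finally show ?thesis .
qed

lemma random_product_state_expectation:
  fixes h :: "(nat \<Rightarrow> nat) \<Rightarrow> real"
  assumes "random_product_state m n p M X" and h: "\<And>x. h (restrict x {1..m}) = h x"
  shows "integrable M (\<lambda>\<omega>. h (\<lambda>l. X l \<omega>))"
    and "(\<integral>\<omega>. h (\<lambda>l. X l \<omega>) \<partial>M) =
      (\<Sum>x\<in>product_states m n. measure M {\<omega> \<in> space M. (\<lambda>l\<in>{1..m}. X l \<omega>) = x} * h x)"
proof -
  interpret prob_space M using assms by (simp add: random_product_state_def)
  have fin: "finite (product_states m n)"
    unfolding product_states_def by (intro finite_PiE) auto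
  note * = expectation_finite_range[OF random_product_state_measurable[OF assms(1)] fin, where F = h]
  show "integrable M (\<lambda>\<omega>. h (\<lambda>l. X l \<omega>))" using *(1) unfolding h .
  show "(\<integral>\<omega>. h (\<lambda>l. X l \<omega>) \<partial>M) =
      (\<Sum>x\<in>product_states m n. measure M {\<omega> \<in> space M. (\<lambda>l\<in>{1..m}. X l \<omega>) = x} * h x)"
    using *(2) unfolding h .
qed

text \<open>Here \<open>h\<close> ignores coordinate \<open>l\<close>, as \<open>rest_wealth\<close>
  does.\<close>

lemma random_product_state_expectation_indep:
  fixes h :: "(nat \<Rightarrow> nat) \<Rightarrow> real"
  assumes rps: "random_product_state m n p M X" and h: "\<And>x. h (restrict x ({1..m} - {l})) = h x"
    and li: "l \<in> {1..m}" "i \<in> {1..n l}"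
  shows "(\<integral>\<omega>. of_bool (X l \<omega> = i) * h (\<lambda>r. X r \<omega>) \<partial>M) = p l i * (\<integral>\<omega>. h (\<lambda>r. X r \<omega>) \<partial>M)"
proof -
  interpret prob_space M using assms by (simp add: random_product_state_def)
  have ind: "indep_vars (\<lambda>l. count_space {1..n l}) X {1..m}"
    using rps by (simp add: random_product_state_def)
  have "prob {\<omega> \<in> space M. X l \<omega> = i} = p l i"
    using rps li by (simp add: random_product_state_def)
  then show ?thesis
    using expectation_of_bool_mult_indep[OF ind, of l i h] li unfolding h by simp
qed

text \<open>Measurability into \<open>count_space {1..n l}\<close> gives this at every point of the
  space, not only almost surely.\<close>

lemma random_product_state_in_range:
  assumes "random_product_state m n p M X" "\<omega> \<in> space M" "l \<in> {1..m}"
  shows "X l \<omega> \<in> {1..n l}"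
proof -
  interpret prob_space M using assms by (simp add: random_product_state_def)
  have "X l \<in> measurable M (count_space {1..n l})"
    using assms by (auto simp: random_product_state_def indep_vars_def2)
  from measurable_space[OF this assms(2)] show ?thesis by simp
qed

section \<open>Terminal wealth and rest wealth\<close>

lemma wealth_restrict [simp]: "wealth m c g (restrict x {Suc 0..m}) = wealth m c g x"
  by (simp add: wealth_def)

lemma rest_wealth_restrict [simp]:
  "rest_wealth m l c g (restrict x ({Suc 0..m} - {l})) = rest_wealth m l c g x"
  by (simp add: rest_wealth_def)

lemma wealth_eq_rest_wealth:
  "l \<in> {1..m} \<Longrightarrow> wealth m c g x = g l (x l) + rest_wealth m l c g x"
  unfolding wealth_def rest_wealth_def by (subst sum.remove[of _ l]) auto

text \<open>Feasibility bounds only the full wealth away from zero. Positive cash keeps the rest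
  wealth positive as well, inside the domain of \<open>U\<close>.\<close>

lemma rest_wealth_pos:
  assumes "feasible m n \<pi> c g" "c > 0" "\<And>r. r \<in> {1..m} \<Longrightarrow> x r \<in> {1..n r}"
  shows "rest_wealth m l c g x > 0"
  using assms unfolding rest_wealth_def feasible_def
  by (intro add_pos_nonneg sum_nonneg) auto

section \<open>Stationarity at the restricted optimum\<close>

text \<open>Since \<open>c > 0\<close> and \<open>g l i > 0\<close>, the stake can move in both
  directions, which gives an equality rather than an inequality. The indicator form leaves
  independence to be applied afterwards.\<close>

lemma first_order_condition:
  assumes adm: "admissible_utility U" and rps: "random_product_state m n p M X"
    and A: "\<And>l. l \<in> {1..m} \<Longrightarrow> A l \<subseteq> {1..n l}"
    and opt: "restricted_optimum M X m n \<pi> U A c g" and c: "c > 0"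
    and l: "l \<in> {1..m}" and i: "i \<in> A l"
  shows "(\<integral>\<omega>. of_bool (X l \<omega> = i) * deriv U (wealth m c g (\<lambda>r. X r \<omega>)) \<partial>M) =
    \<pi> l i * (\<integral>\<omega>. deriv U (wealth m c g (\<lambda>r. X r \<omega>)) \<partial>M)"
proof -
  let ?W = "\<lambda>x. wealth m c g x"
  let ?P = "\<lambda>x. measure M {\<omega> \<in> space M. (\<lambda>r\<in>{1..m}. X r \<omega>) = x}"
  have feas: "feasible m n \<pi> c g" and supp: "supported_on m n A g"
    using opt by (auto simp: restricted_optimum_def)
  have i': "i \<in> {1..n l}" using A l i by blast
  have gli: "g l i > 0" using supp l i by (auto simp: supported_on_def)
  \<comment> \<open>The stake on \<open>(l, i)\<close> grows by \<open>t\<close>; paying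
    \<open>\<pi> l i * t\<close> out of cash preserves the budget.\<close>
  define g' where "g' t = g(l := (g l)(i := g l i + t))" for t
  have g'_eq: "g' t r j = g r j + t * (if r = l then of_bool (j = i) else 0)" for t r j
    by (simp add: g'_def)
  \<comment> \<open>Wealth in each state is affine in \<open>t\<close>, with slope equal to the
    payoff of the bet minus its price.\<close>
  have W_eq: "wealth m (c - \<pi> l i * t) (g' t) x = ?W x + t * (of_bool (x l = i) - \<pi> l i)" for t x
  proof -
    have "(\<Sum>r=1..m. g' t r (x r)) =
        (\<Sum>r=1..m. g r (x r)) + t * (\<Sum>r=1..m. if r = l then of_bool (x r = i) else 0)"
      unfolding g'_eq sum.distrib sum_distrib_left ..
    also have "(\<Sum>r=1..m. if r = l then of_bool (x r = i) else (0::real)) = of_bool (x l = i)"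
      using l by simp
    finally show ?thesis by (simp add: wealth_def algebra_simps)
  qed
  have budget: "(\<Sum>r=1..m. \<Sum>j=1..n r. \<pi> r j * g' t r j) =
      (\<Sum>r=1..m. \<Sum>j=1..n r. \<pi> r j * g r j) + \<pi> l i * t" for t
  proof -
    have "(\<Sum>j=1..n r. \<pi> r j * g' t r j) =
        (\<Sum>j=1..n r. \<pi> r j * g r j) + (if r = l then \<pi> l i * t else 0)" for r
    proof (cases "r = l")
      case True
      have "(\<Sum>j=1..n l. \<pi> l j * g' t l j) =
          (\<Sum>j=1..n l. \<pi> l j * g l j + (if j = i then \<pi> l i * t else 0))"
        by (intro sum.cong) (auto simp: g'_eq algebra_simps)
      also have "\<dots> = (\<Sum>j=1..n l. \<pi> l j * g l j) + \<pi> l i * t"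
        using i' by (simp add: sum.distrib)
      finally show ?thesis using True by simp
    qed (simp add: g'_eq)
    then show ?thesis using l by (simp add: sum.distrib)
  qed
  obtain d where d: "d > 0" "d \<le> g l i / 2" "\<bar>\<pi> l i\<bar> * d \<le> c / 2"
  proof
    \<comment> \<open>At most half of the stake and half of the cash is used up. The summand
      \<open>1\<close> keeps the denominator positive, and the absolute value covers both signs of
      the cash change.\<close>
    let ?d = "min (g l i / 2) (c / (2 * (\<bar>\<pi> l i\<bar> + 1)))"
    show "?d > 0" using gli c by simp
    show "?d \<le> g l i / 2" by (rule min.cobounded1)
    have "\<bar>\<pi> l i\<bar> * ?d \<le> (\<bar>\<pi> l i\<bar> + 1) * (c / (2 * (\<bar>\<pi> l i\<bar> + 1)))"
      using gli c by (intro mult_mono) auto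
    also have "\<dots> = c / 2" by (simp add: field_simps)
    finally show "\<bar>\<pi> l i\<bar> * ?d \<le> c / 2" .
  qed
  have feas': "feasible m n \<pi> (c - \<pi> l i * t) (g' t) \<and> supported_on m n A (g' t)"
    if t: "\<bar>t\<bar> < d" for t
  proof -
    have "\<bar>\<pi> l i * t\<bar> \<le> \<bar>\<pi> l i\<bar> * d"
      unfolding abs_mult using t by (intro mult_left_mono) auto
    then have c': "c - \<pi> l i * t > 0" using d(3) c by linarith
    have gt: "g l i + t > 0" using t d(2) gli by linarith
    have nn: "g' t r j \<ge> 0" if "r \<in> {1..m}" "j \<in> {1..n r}" for r j
      using feas that gt by (auto simp: feasible_def g'_def)
    have "wealth m (c - \<pi> l i * t) (g' t) x > 0" if "x \<in> product_states m n" for x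
      unfolding wealth_def using c' nn that
      by (intro add_pos_nonneg sum_nonneg) (auto simp: product_states_def PiE_iff)
    moreover have "c - \<pi> l i * t + (\<Sum>r=1..m. \<Sum>j=1..n r. \<pi> r j * g' t r j) = 1"
      unfolding budget using feas by (simp add: feasible_def)
    moreover have "supported_on m n A (g' t)"
      using supp gt i unfolding supported_on_def g'_def by auto
    ultimately show ?thesis using c' nn by (simp add: feasible_def)
  qed
  define \<phi> where "\<phi> t = expected_utility M X m U (c - \<pi> l i * t) (g' t)" for t
  have \<phi>_eq: "\<phi> = (\<lambda>t. \<Sum>x\<in>product_states m n. ?P x * U (?W x + t * (of_bool (x l = i) - \<pi> l i)))"
  proof
    fix t
    show "\<phi> t = (\<Sum>x\<in>product_states m n. ?P x * U (?W x + t * (of_bool (x l = i) - \<pi> l i)))"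
      unfolding \<phi>_def expected_utility_def
      by (subst random_product_state_expectation(2)[OF rps]) (simp_all add: W_eq)
  qed
  have U': "(U has_real_derivative deriv U w) (at w)" if "w > 0" for w
    using adm that unfolding admissible_utility_def C1_differentiable_on_eq
    by (metis DERIV_deriv_iff_real_differentiable greaterThan_iff)
  \<comment> \<open>At \<open>t = 0\<close> every state has its original, positive wealth, so
    \<open>U\<close> is differentiable there.\<close>
  have "(\<phi> has_real_derivative
      (\<Sum>x\<in>product_states m n. ?P x * (deriv U (?W x) * (of_bool (x l = i) - \<pi> l i)))) (at 0)"
    unfolding \<phi>_eq
  proof (intro DERIV_sum DERIV_cmult)
    fix x assume "x \<in> product_states m n"
    then have "?W x > 0" using feas by (simp add: feasible_def)
    then show "((\<lambda>t. U (?W x + t * (of_bool (x l = i) - \<pi> l i))) has_real_derivative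
        deriv U (?W x) * (of_bool (x l = i) - \<pi> l i)) (at 0)"
      by (intro DERIV_chain2[where f = U]) (auto intro!: derivative_eq_intros U')
  qed
  \<comment> \<open>The portfolios with \<open>\<bar>t\<bar> < d\<close> all compete with the
    optimum, so \<open>\<phi>\<close> has an interior maximum at \<open>0\<close>.\<close>
  then have "(\<Sum>x\<in>product_states m n. ?P x * (deriv U (?W x) * (of_bool (x l = i) - \<pi> l i))) = 0"
  proof (rule DERIV_local_max[OF _ d(1)], intro allI impI)
    fix t :: real assume "\<bar>0 - t\<bar> < d"
    then have "feasible m n \<pi> (c - \<pi> l i * t) (g' t) \<and> supported_on m n A (g' t)"
      by (intro feas') simp
    then have "\<phi> t \<le> expected_utility M X m U c g"
      using opt by (simp add: \<phi>_def restricted_optimum_def)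
    then show "\<phi> t \<le> \<phi> 0" by (simp add: \<phi>_def g'_def)
  qed
  then have "(\<Sum>x\<in>product_states m n. ?P x * (of_bool (x l = i) * deriv U (?W x))) =
      \<pi> l i * (\<Sum>x\<in>product_states m n. ?P x * deriv U (?W x))"
    by (simp add: algebra_simps sum_subtractf sum_distrib_left)
  then show ?thesis
    using l random_product_state_expectation(2)[OF rps, where h = "\<lambda>x. deriv U (?W x)"]
      random_product_state_expectation(2)[OF rps,
        where h = "\<lambda>x. of_bool (x l = i) * deriv U (?W x)"]
    by simp
qed

(* If A l contains every outcome of event l, then both 1 - P and 1 - Q vanish and the
   quotient is 0/0; the first conjunct, with the denominator 1 - Q cleared, is the form of
   the identity that is meaningful in that case too.  Otherwise the quotient is well defined. *)
theorem theorem3: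
  fixes m :: nat and n :: "nat \<Rightarrow> nat"
    and p \<pi> :: "nat \<Rightarrow> nat \<Rightarrow> real"
    and U :: "real \<Rightarrow> real"
    and M :: "'w measure" and X :: "nat \<Rightarrow> 'w \<Rightarrow> nat"
    and A :: "nat \<Rightarrow> nat set"
    and c :: real and g :: "nat \<Rightarrow> nat \<Rightarrow> real"
  assumes "m \<ge> 1"
    and "\<And>l i. l \<in> {1..m} \<Longrightarrow> i \<in> {1..n l} \<Longrightarrow> p l i > 0"
    and "\<And>l. l \<in> {1..m} \<Longrightarrow> (\<Sum>i=1..n l. p l i) = 1"
    and "\<And>l i. l \<in> {1..m} \<Longrightarrow> i \<in> {1..n l} \<Longrightarrow> \<pi> l i > 0"
    and "admissible_utility U"
    and "random_product_state m n p M X"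
    and "\<And>l. l \<in> {1..m} \<Longrightarrow> A l \<subseteq> {1..n l}"
    and "restricted_optimum M X m n \<pi> U A c g"
    and "c > 0"
  shows "(\<exists>!lam. budget_multiplier M X m p \<pi> U A c g lam) \<and>
    (\<forall>lam. budget_multiplier M X m p \<pi> U A c g lam \<longrightarrow>
      (\<forall>l\<in>{1..m}.
        lam / K_factor M X m U c g l * (1 - (\<Sum>i\<in>A l. \<pi> l i)) = 1 - (\<Sum>i\<in>A l. p l i) \<and>
        (A l \<noteq> {1..n l} \<longrightarrow>
          (\<Sum>i\<in>A l. \<pi> l i) < 1 \<and>
          lam / K_factor M X m U c g l = (1 - (\<Sum>i\<in>A l. p l i)) / (1 - (\<Sum>i\<in>A l. \<pi> l i)))))"
proof -
  interpret prob_space M using assms(6) by (simp add: random_product_state_def)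
  note p = assms(2) and p_sum = assms(3) and adm = assms(5) and rps = assms(6) and A = assms(7)
    and opt = assms(8) and c = assms(9)
  let ?W = "\<lambda>\<omega>. wealth m c g (\<lambda>r. X r \<omega>)" and ?R = "\<lambda>l \<omega>. rest_wealth m l c g (\<lambda>r. X r \<omega>)"
  have feas: "feasible m n \<pi> c g" and supp: "supported_on m n A g"
    using opt by (auto simp: restricted_optimum_def)
  have U'_pos: "deriv U w > 0" if "w > 0" for w
    using adm that by (simp add: admissible_utility_def)
  have expectation_pos: "expectation f > 0" if "integrable M f" "\<And>\<omega>. \<omega> \<in> space M \<Longrightarrow> f \<omega> > 0"
    for f :: "'w \<Rightarrow> real"
    using that expectation_greater[of f 0] by simp
  have R_pos: "?R l \<omega> > 0" if "\<omega> \<in> space M" for l \<omega>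
    using random_product_state_in_range[OF rps that] by (intro rest_wealth_pos[OF feas c]) auto
  have W_int: "integrable M (\<lambda>\<omega>. deriv U (?W \<omega>))"
    by (rule random_product_state_expectation(1)[OF rps, where h = "\<lambda>x. deriv U (wealth m c g x)"])
      simp
  \<comment> \<open>On the event \<open>X l = i\<close> the wealth is \<open>g l i\<close> plus the
    rest wealth, and the latter is independent of \<open>X l\<close>.\<close>
  have split: "expectation (\<lambda>\<omega>. of_bool (X l \<omega> = i) * deriv U (?W \<omega>)) =
      p l i * expectation (\<lambda>\<omega>. deriv U (g l i + ?R l \<omega>))"
    if li: "l \<in> {1..m}" "i \<in> {1..n l}" for l i
  proof -
    have "expectation (\<lambda>\<omega>. of_bool (X l \<omega> = i) * deriv U (?W \<omega>)) =
        expectation (\<lambda>\<omega>. of_bool (X l \<omega> = i) * deriv U (g l i + ?R l \<omega>))"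
      using li by (intro Bochner_Integration.integral_cong) (auto simp: wealth_eq_rest_wealth)
    also have "\<dots> = p l i * expectation (\<lambda>\<omega>. deriv U (g l i + ?R l \<omega>))"
      using random_product_state_expectation_indep[OF rps _ li,
          where h = "\<lambda>x. deriv U (g l i + rest_wealth m l c g x)"] by simp
    finally show ?thesis .
  qed
  \<comment> \<open>The second clause of \<open>budget_multiplier\<close> forces this value, so
    uniqueness is immediate and only existence needs the first-order conditions.\<close>
  define \<Lambda> where "\<Lambda> = expectation (\<lambda>\<omega>. deriv U (?W \<omega>))"
  have "\<Lambda> > 0"
    unfolding \<Lambda>_def
  proof (intro expectation_pos W_int U'_pos)
    fix \<omega> assume "\<omega> \<in> space M"
    then have "(\<lambda>l\<in>{1..m}. X l \<omega>) \<in> product_states m n"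
      using measurable_space[OF random_product_state_measurable[OF rps]] by simp
    then have "wealth m c g (\<lambda>l\<in>{1..m}. X l \<omega>) > 0"
      using feas unfolding feasible_def by blast
    then show "?W \<omega> > 0" by simp
  qed
  have multiplier: "budget_multiplier M X m p \<pi> U A c g \<Lambda>"
    unfolding budget_multiplier_def
  proof (intro conjI ballI)
    fix l i assume li: "l \<in> {1..m}" "i \<in> A l"
    then have i': "i \<in> {1..n l}" using A by blast
    show "p l i * expectation (\<lambda>\<omega>. deriv U (g l i + ?R l \<omega>)) = \<Lambda> * \<pi> l i"
      using first_order_condition[OF adm rps A opt c li] split[OF li(1) i'] by (simp add: \<Lambda>_def)
  qed (use \<open>\<Lambda> > 0\<close> in \<open>simp_all add: \<Lambda>_def\<close>)
  have unique: "lam = \<Lambda>" if "budget_multiplier M X m p \<pi> U A c g lam" for lam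
    using that by (simp add: budget_multiplier_def \<Lambda>_def)
  have main: "\<Lambda> / K_factor M X m U c g l * (1 - (\<Sum>i\<in>A l. \<pi> l i)) = 1 - (\<Sum>i\<in>A l. p l i) \<and>
        (A l \<noteq> {1..n l} \<longrightarrow>
          (\<Sum>i\<in>A l. \<pi> l i) < 1 \<and>
          \<Lambda> / K_factor M X m U c g l = (1 - (\<Sum>i\<in>A l. p l i)) / (1 - (\<Sum>i\<in>A l. \<pi> l i)))"
    if l: "l \<in> {1..m}" for l
  proof -
    let ?K = "K_factor M X m U c g l"
    let ?P = "\<Sum>i\<in>A l. p l i" and ?Q = "\<Sum>i\<in>A l. \<pi> l i"
    have K_int: "integrable M (\<lambda>\<omega>. deriv U (?R l \<omega>))"
      by (rule random_product_state_expectation(1)[OF rps,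
            where h = "\<lambda>x. deriv U (rest_wealth m l c g x)"]) (simp add: rest_wealth_def)
    have K: "?K > 0"
      unfolding K_factor_def by (intro expectation_pos K_int U'_pos R_pos)
    have rest: "(\<Sum>i\<in>{1..n l} - A l. p l i) = 1 - ?P"
      using p_sum[OF l] sum.subset_diff[OF A[OF l], of "p l"] by simp
    have int: "integrable M (\<lambda>\<omega>. of_bool (X l \<omega> = i) * deriv U (?W \<omega>))" for i
      using l by (intro random_product_state_expectation(1)[OF rps,
            where h = "\<lambda>x. of_bool (x l = i) * deriv U (wealth m c g x)"]) simp
    \<comment> \<open>The indicators of the values of \<open>X l\<close> sum to one.\<close>
    have "\<Lambda> = expectation (\<lambda>\<omega>. \<Sum>i=1..n l. of_bool (X l \<omega> = i) * deriv U (?W \<omega>))"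
      unfolding \<Lambda>_def
    proof (intro Bochner_Integration.integral_cong refl)
      fix \<omega> assume "\<omega> \<in> space M"
      then have "X l \<omega> \<in> {1..n l}" using random_product_state_in_range[OF rps _ l] by blast
      then have "(\<Sum>i=1..n l. of_bool (X l \<omega> = i)) = (1::real)"
        by (simp add: of_bool_def)
      then show "deriv U (?W \<omega>) = (\<Sum>i=1..n l. of_bool (X l \<omega> = i) * deriv U (?W \<omega>))"
        by (simp flip: sum_distrib_right)
    qed
    also have "\<dots> = (\<Sum>i=1..n l. expectation (\<lambda>\<omega>. of_bool (X l \<omega> = i) * deriv U (?W \<omega>)))"
      by (rule Bochner_Integration.integral_sum[OF int])
    also have "\<dots> = (\<Sum>i\<in>{1..n l} - A l. expectation (\<lambda>\<omega>. of_bool (X l \<omega> = i) * deriv U (?W \<omega>))) +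
        (\<Sum>i\<in>A l. expectation (\<lambda>\<omega>. of_bool (X l \<omega> = i) * deriv U (?W \<omega>)))"
      using A[OF l] by (intro sum.subset_diff) auto
    also have "(\<Sum>i\<in>A l. expectation (\<lambda>\<omega>. of_bool (X l \<omega> = i) * deriv U (?W \<omega>))) =
        (\<Sum>i\<in>A l. \<pi> l i * \<Lambda>)"
      unfolding \<Lambda>_def using first_order_condition[OF adm rps A opt c l] by (intro sum.cong) auto
    also have "\<dots> = ?Q * \<Lambda>" by (simp add: sum_distrib_right)
    \<comment> \<open>Off the support \<open>g l i = 0\<close>, so the factor supplied by
      \<open>split\<close> is \<open>?K\<close>.\<close>
    also have "(\<Sum>i\<in>{1..n l} - A l. expectation (\<lambda>\<omega>. of_bool (X l \<omega> = i) * deriv U (?W \<omega>))) =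
        (\<Sum>i\<in>{1..n l} - A l. p l i * ?K)"
      using supp l split by (intro sum.cong) (auto simp: supported_on_def K_factor_def)
    also have "\<dots> = (1 - ?P) * ?K" unfolding rest[symmetric] by (rule sum_distrib_right[symmetric])
    \<comment> \<open>If \<open>A l\<close> contains all outcomes, both sides are zero.\<close>
    finally have eq: "\<Lambda> * (1 - ?Q) = (1 - ?P) * ?K" by (simp add: algebra_simps)
    then have first: "\<Lambda> / ?K * (1 - ?Q) = 1 - ?P" using K by (simp add: field_simps)
    \<comment> \<open>The bound is a consequence of optimality: a missing outcome has positive
      probability, so the right side of \<open>eq\<close> is positive, and so is
      \<open>\<Lambda>\<close>.\<close>
    have Q: "?Q < 1" if "A l \<noteq> {1..n l}"
    proof -
      have "(\<Sum>i\<in>{1..n l} - A l. p l i) > 0"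
        using that A[OF l] p[OF l] by (intro sum_pos) auto
      then have "\<Lambda> * (1 - ?Q) > 0" using K unfolding eq rest by simp
      then show ?thesis using \<open>\<Lambda> > 0\<close> by (simp add: zero_less_mult_iff)
    qed
    show ?thesis
    proof (intro conjI impI)
      assume "A l \<noteq> {1..n l}"
      then show "?Q < 1" by (rule Q)
      then show "\<Lambda> / ?K = (1 - ?P) / (1 - ?Q)" using first eq_divide_eq by force
    qed (rule first)
  qed
  show ?thesis
    using multiplier unique main by blast
qed

end
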